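(* Let $w_{1},w_{2},w_{3}$ be any positive integers and $n\ge0$ an integer. Then for all $y$: \begin{align*} &\sum_{k+l+m=n}\binom{n}{k,l,m}E_{k}(w_{1}y)E_{l}(w_{2}y)E_{m}(w_{3}y)w_{3}^{k}w_{1}^{l}w_{2}^{m}\\ =&\sum_{k+l+m=n}\binom{n}{k,l,m}E_{k}(w_{1}y)E_{l}(w_{3}y)E_{m}(w_{2}y)w_{2}^{k}w_{1}^{l}w_{3}^{m}. \end{align*}
   Context: The Euler polynomials $E_n(x)$ are defined by $\frac{2}{e^{t}+1}e^{xt}=\sum_{n=0}^{\infty}E_{n}(x)\frac{t^{n}}{n!}$. Sums $\sum_{k+l+m=n}$ run over all nonnegative integers $k,l,m$ with $k+l+m=n$, and $\binom{n}{k,l,m}=\frac{n!}{k!\,l!\,m!}$. *)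

theory Defs
  imports "HOL-Computational_Algebra.Formal_Power_Series"
begin

text \<open>
  The value \<open>E\<^sub>n(x)\<close> is read off the formal power series in \<open>t\<close>
  \<open>2 / (e\<^sup>t + 1) * e\<^bsup>xt\<^esup> = (\<Sum>n. E\<^sub>n(x) * t\<^sup>n / n!)\<close>;
  here \<open>fps_exp x\<close> is \<open>e\<^bsup>xt\<^esup>\<close>. The division is genuine, as \<open>e\<^sup>t + 1\<close> has
  constant coefficient \<open>2 \<noteq> 0\<close>.
\<close>
definition euler_poly :: "nat \<Rightarrow> 'a::field_char_0 \<Rightarrow> 'a" where
  "euler_poly n x = fact n * fps_nth (fps_const 2 / (fps_exp 1 + 1) * fps_exp x) n"

lemma euler_poly_gen_fun:
  fixes x :: "'a::field_char_0"
  shows "fps_const 2 / (fps_exp 1 + 1) * fps_exp x = Abs_fps (\<lambda>n. euler_poly n x / fact n)"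
  by (rule fps_ext) (simp add: euler_poly_def)

lemma euler_poly_gen_fun_mult:
  fixes x :: "'a::field_char_0"
  shows "Abs_fps (\<lambda>n. euler_poly n x / fact n) * (fps_exp 1 + 1) = fps_const 2 * fps_exp x"
proof -
  have unit: "fps_nth (fps_exp 1 + 1 :: 'a fps) 0 \<noteq> 0" by simp
  have "fps_const 2 / (fps_exp 1 + 1) * fps_exp x * (fps_exp 1 + 1)
      = fps_const 2 * fps_exp x * (inverse (fps_exp 1 + 1) * (fps_exp 1 + 1))"
    by (simp only: fps_divide_unit[OF unit] mult_ac)
  then show ?thesis
    by (simp only: euler_poly_gen_fun inverse_mult_eq_1[OF unit] mult_1_right)
qed

text \<open>The triples \<open>(k, l, m)\<close> of naturals with \<open>k + l + m = n\<close>.\<close>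
definition triples_sum :: "nat \<Rightarrow> (nat \<times> nat \<times> nat) set" where
  "triples_sum n = {(k, l, m). k + l + m = n}"

lemma finite_triples_sum: "finite (triples_sum n)"
  by (rule finite_subset[of _ "{..n} \<times> {..n} \<times> {..n}"]) (auto simp: triples_sum_def)

definition trinomial :: "nat \<Rightarrow> nat \<Rightarrow> nat \<Rightarrow> nat \<Rightarrow> 'a::field_char_0" where
  "trinomial n k l m = fact n / (fact k * fact l * fact m)"

end

theory Submission
  imports Defs
begin

text \<open>
  Up to the factor \<open>n!\<close>, the left-hand side is the coefficient of \<open>t\<^sup>n\<close> in
  \<open>8 e\<^bsup>(w\<^sub>1w\<^sub>2 + w\<^sub>2w\<^sub>3 + w\<^sub>3w\<^sub>1)yt\<^esup> / ((e\<^bsup>w\<^sub>1t\<^esup> + 1)(e\<^bsup>w\<^sub>2t\<^esup> + 1)(e\<^bsup>w\<^sub>3t\<^esup> + 1))\<close>,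
  which is symmetric in \<open>w\<^sub>1, w\<^sub>2, w\<^sub>3\<close>; the right-hand side arises by exchanging
  \<open>w\<^sub>2\<close> and \<open>w\<^sub>3\<close>.
\<close>

text \<open>The series of 2 e^(wxt) / (e^(wt) + 1): the Euler generating function with t replaced by
  wt, so that the powers of the weights in the sums are absorbed.\<close>

definition euler_fps :: "'a::field_char_0 \<Rightarrow> 'a \<Rightarrow> 'a fps" where
  "euler_fps w x = Abs_fps (\<lambda>n. euler_poly n x / fact n * w ^ n)"

text \<open>Substituting wt for t is a ring homomorphism, so it carries over the identity that
  defines the Euler polynomials. The product form avoids division.\<close>

lemma euler_fps_mult:
  fixes w x :: "'a::field_char_0"
  shows "euler_fps w x * (fps_exp w + 1) = fps_const 2 * fps_exp (w * x)"
proof -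
  let ?L = "fps_const w * fps_X :: 'a fps"
  have "euler_fps w x = Abs_fps (\<lambda>n. euler_poly n x / fact n) oo ?L"
    unfolding euler_fps_def fps_compose_linear by (simp add: mult.commute)
  moreover have "fps_exp w + 1 = (fps_exp 1 + 1) oo ?L"
    by (simp add: fps_compose_add_distrib)
  moreover have "fps_const 2 * fps_exp (w * x) = (fps_const 2 * fps_exp x) oo ?L"
    by (simp add: fps_compose_mult_distrib mult.commute [of w x])
  ultimately show ?thesis
    by (simp add: fps_compose_mult_distrib [symmetric] euler_poly_gen_fun_mult)
qed

lemma fps_mult_nth_triples_sum:
  fixes f g h :: "'a::field_char_0 fps"
  shows "fps_nth (f * g * h) n
    = (\<Sum>(k, l, m) \<in> triples_sum n. fps_nth f k * fps_nth g l * fps_nth h m)"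
proof -
  have "fps_nth (f * (g * h)) n
      = (\<Sum>k\<in>{0..n}. \<Sum>l\<in>{0..n - k}. fps_nth f k * fps_nth g l * fps_nth h (n - k - l))"
    by (simp add: fps_mult_nth sum_distrib_left mult.assoc)
  also have "\<dots> = (\<Sum>(k, l) \<in> (SIGMA k:{0..n}. {0..n - k}).
      fps_nth f k * fps_nth g l * fps_nth h (n - k - l))"
    by (simp add: sum.Sigma)
  also have "\<dots> = (\<Sum>(k, l, m) \<in> triples_sum n. fps_nth f k * fps_nth g l * fps_nth h m)"
    \<comment> \<open>The entry m is determined by k and l; since l is at most n - k, the truncated
      subtraction is exact.\<close>
    by (rule sum.reindex_bij_witness
        [where i = "\<lambda>(k, l, m). (k, l)" and j = "\<lambda>(k, l). (k, l, n - k - l)"])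
      (auto simp: triples_sum_def)
  finally show ?thesis by (simp only: mult.assoc)
qed

text \<open>The three factorials under the trinomial coefficient go one to each series, leaving n!
  in front.\<close>

lemma sum_euler_poly_eq_fps_nth:
  fixes a b c x y z :: "'a::field_char_0"
  shows "(\<Sum>(k, l, m) \<in> triples_sum n. trinomial n k l m *
      euler_poly k x * euler_poly l y * euler_poly m z * a ^ k * b ^ l * c ^ m)
    = fact n * fps_nth (euler_fps a x * euler_fps b y * euler_fps c z) n"
  unfolding fps_mult_nth_triples_sum sum_distrib_left
  by (rule sum.cong) (auto simp: trinomial_def euler_fps_def)

lemma euler_fps_prod_mult:
  fixes a b c x y z :: "'a::field_char_0"
  shows "euler_fps a x * euler_fps b y * euler_fps c z *
      ((fps_exp a + 1) * (fps_exp b + 1) * (fps_exp c + 1))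
    = fps_const 2 ^ 3 * fps_exp (a * x + b * y + c * z)"
proof -
  have "euler_fps a x * euler_fps b y * euler_fps c z *
      ((fps_exp a + 1) * (fps_exp b + 1) * (fps_exp c + 1))
    = (euler_fps a x * (fps_exp a + 1)) * (euler_fps b y * (fps_exp b + 1)) *
      (euler_fps c z * (fps_exp c + 1))"
    by (simp only: mult_ac)
  then show ?thesis
    by (simp only: euler_fps_mult fps_exp_add_mult power3_eq_cube mult_ac)
qed

theorem theorem16:
  fixes w1 w2 w3 n :: nat and y :: "'a::field_char_0"
  assumes "w1 > 0" and "w2 > 0" and "w3 > 0"
  shows
    "(\<Sum>(k, l, m) \<in> triples_sum n. trinomial n k l m *
        euler_poly k (of_nat w1 * y) * euler_poly l (of_nat w2 * y) * euler_poly m (of_nat w3 * y) *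
        of_nat w3 ^ k * of_nat w1 ^ l * of_nat w2 ^ m)
   = (\<Sum>(k, l, m) \<in> triples_sum n. trinomial n k l m *
        euler_poly k (of_nat w1 * y) * euler_poly l (of_nat w3 * y) * euler_poly m (of_nat w2 * y) *
        of_nat w2 ^ k * of_nat w1 ^ l * of_nat w3 ^ m)"
proof -
  define a b c :: 'a where "a = of_nat w1" and "b = of_nat w2" and "c = of_nat w3"
  let ?D = "(fps_exp a + 1) * (fps_exp b + 1) * (fps_exp c + 1)"
  let ?P = "euler_fps c (a * y) * euler_fps a (b * y) * euler_fps b (c * y)"
  let ?Q = "euler_fps b (a * y) * euler_fps a (c * y) * euler_fps c (b * y)"
  \<comment> \<open>Each weight is paired with the argument it accompanies in the sum; the exponent
    becomes (ab + bc + ca)y for \<open>?P\<close> and \<open>?Q\<close> alike.\<close>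
  have "?P * ?D = fps_const 2 ^ 3 * fps_exp (c * (a * y) + a * (b * y) + b * (c * y))"
    unfolding euler_fps_prod_mult [symmetric] by (simp only: mult_ac)
  also have "c * (a * y) + a * (b * y) + b * (c * y) = b * (a * y) + a * (c * y) + c * (b * y)"
    by (simp add: algebra_simps)
  also have "fps_const 2 ^ 3 * fps_exp \<dots> = ?Q * ?D"
    unfolding euler_fps_prod_mult [symmetric] by (simp only: mult_ac)
  finally have "?P * ?D = ?Q * ?D" .
  \<comment> \<open>The constant coefficient is 8, and power series over a field have no zero
    divisors, so \<open>?D\<close> cancels.\<close>
  moreover have "fps_nth ?D 0 \<noteq> 0" by simp
  then have "?D \<noteq> 0" by (metis fps_zero_nth)
  ultimately have "?P = ?Q" using mult_right_cancel by blast
  then show ?thesis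
    by (simp only: sum_euler_poly_eq_fps_nth a_def b_def c_def)
qed

end
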